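(* Let $G$ be an abelian group, $\mu$ a measure on $G$, and let $f,k\colon G\to\mathbb{C}$ be nonzero functions such that the integral $$\int\bigl[f(x+y-t)+f(x-y+t)\bigr]\,d\mu(t)$$ exists for each $x,y\in G$, and such that $$\int\bigl[f(x+y-t)+f(x-y+t)\bigr]\,d\mu(t)=k(x)f(y)\qquad\text{for all }x,y\in G.\tag{$*$}$$ Then one of the following holds: (i) $f(x)=\alpha\widehat{\mu}(m)m(x)+\alpha\widehat{\mu}(\check{m})m(-x)$ and $k(x)=\widehat{\mu}(m)m(x)+\widehat{\mu}(\check{m})m(-x)$ for each $x\in G$, where $m$ is a non-even exponential and $\alpha$ is a non-zero complex constant; (ii) $f(x)=2\alpha\widehat{\mu}(m_0)m_0(x)$ and $k(x)=2\widehat{\mu}(m_0)m_0(x)$ for each $x\in G$, where $m_0$ is an even exponential with $\widehat{\mu}(m_0)\neq 0$, and $\alpha$ is a non-zero complex constant. Conversely, the functions $f,k$ given in (i) and (ii) are solutions of $( * )$, whenever the given conditions are satisfied. If $G$ is a topological group and $f$ or $k$ is continuous, then $m$ and $m_0$ (whichever occurs) are continuous, too. If $G$ is locally compact and $f$ or $k$ is Haar measurable, then $f,k,m,m_0$ (those that occur) are continuous. If $f$ or $k$ is essentially bounded and Haar measurable, then $f,k,m,m_0$ (those that occur) are continuous, and moreover $m,m_0$ are characters of $G$.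
   Context: For $f\colon G\to\mathbb{C}$ put $\check{f}(x)=f(-x)$; $f$ is even if $\check f=f$. An exponential on $G$ is a nonzero function $m\colon G\to\mathbb{C}$ with $m(x+y)=m(x)m(y)$ for all $x,y\in G$; it is non-even if $m\neq\check m$. Here $\mu$ is a complex measure on $G$, and $\mu$ and the functions are assumed to be such that all integrals involved exist (for instance, $G$ a topological abelian group, $\mu$ a compactly supported Radon measure and $f,k$ continuous; or $G$ discrete and $\mu$ finitely supported). For an exponential $m$ integrable with respect to $\mu$, $\widehat{\mu}(m)=\int\check{m}\,d\mu=\int m(-t)\,d\mu(t)$. In the last regularity statement, essential boundedness and measurability are with respect to Haar measure on the locally compact abelian group $G$, and a character is a continuous homomorphism from $G$ into the multiplicative group of complex numbers of modulus $1$. *)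

theory Defs
  imports "HOL-Analysis.Analysis"
begin

section \<open>Complex measures and their integrals\<close>

definition complex_measure :: "'a set set \<Rightarrow> ('a set \<Rightarrow> complex) \<Rightarrow> bool" where
  "complex_measure \<Sigma> \<mu> \<longleftrightarrow> sigma_algebra UNIV \<Sigma> \<and>
     (\<forall>A :: nat \<Rightarrow> 'a set. range A \<subseteq> \<Sigma> \<longrightarrow> disjoint_family A \<longrightarrow>
        (\<lambda>i. \<mu> (A i)) sums \<mu> (\<Union>i. A i))"

text \<open>
  The positive part of the Jordan decomposition of a real-valued countably additive
  set function. \<open>ennreal\<close> truncates negative values to 0, which does not change the
  supremum because \<open>B = {}\<close> is admissible.
\<close>

definition upper_variation :: "'a set set \<Rightarrow> ('a set \<Rightarrow> real) \<Rightarrow> 'a measure" where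
  "upper_variation \<Sigma> \<nu> =
     measure_of UNIV \<Sigma> (\<lambda>A. SUP B\<in>{B \<in> \<Sigma>. B \<subseteq> A}. ennreal (\<nu> B))"

text \<open>
  \<open>measure_of\<close> yields the null measure on set functions that are not countably additive;
  the following fact shows that this does not happen here.
\<close>

lemma emeasure_upper_variation:
  fixes \<nu> :: "'a set \<Rightarrow> real"
  assumes sa: "sigma_algebra UNIV \<Sigma>"
    and ca: "\<And>A :: nat \<Rightarrow> 'a set. range A \<subseteq> \<Sigma> \<Longrightarrow> disjoint_family A \<Longrightarrow>
               (\<lambda>i. \<nu> (A i)) sums \<nu> (\<Union>i. A i)"
    and X: "X \<in> \<Sigma>"
  shows "emeasure (upper_variation \<Sigma> \<nu>) X = (SUP B\<in>{B \<in> \<Sigma>. B \<subseteq> X}. ennreal (\<nu> B))"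
proof -
  interpret sigma_algebra UNIV \<Sigma> by (rule sa)
  define V where "V A = (SUP B\<in>{B \<in> \<Sigma>. B \<subseteq> A}. ennreal (\<nu> B))" for A
  have nu0: "\<nu> {} = 0"
  proof -
    have "(\<lambda>i::nat. \<nu> {}) sums \<nu> (\<Union>i::nat. {})"
      by (rule ca) (auto simp: disjoint_family_on_def)
    then have "summable (\<lambda>i::nat. \<nu> {})" by (rule sums_summable)
    then show ?thesis by (simp add: summable_const_iff)
  qed
  have nu2: "\<nu> (B \<union> C) = \<nu> B + \<nu> C" if "B \<in> \<Sigma>" "C \<in> \<Sigma>" "B \<inter> C = {}" for B C
  proof -
    have "(\<lambda>i. \<nu> (binaryset B C i)) sums \<nu> (\<Union>i. binaryset B C i)"
      using that by (intro ca) (auto simp: range_binaryset_eq disjoint_family_on_def binaryset_def)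
    moreover have "(\<lambda>i. \<nu> (binaryset B C i)) sums (\<nu> B + \<nu> C)"
      by (rule binaryset_sums) (rule nu0)
    ultimately show ?thesis
      by (metis UN_binaryset_eq sums_unique2)
  qed
  have le_V: "ennreal (\<nu> B) \<le> V A" if "B \<in> \<Sigma>" "B \<subseteq> A" for A B
    unfolding V_def using that by (intro SUP_upper) auto
  have V_mono: "V A \<le> V B" if "A \<subseteq> B" for A B
    unfolding V_def using that by (intro SUP_subset_mono) auto
  have V0: "V {} = 0"
  proof -
    have "V {} \<le> 0" unfolding V_def by (intro SUP_least) (auto simp: nu0)
    then show ?thesis by simp
  qed
  have V_super: "V A + V B \<le> V (A \<union> B)" if AB: "A \<inter> B = {}" for A B
  proof -
    have *: "ennreal (\<nu> C) + ennreal (\<nu> D) \<le> V (A \<union> B)"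
      if "C \<in> \<Sigma>" "D \<in> \<Sigma>" "C \<subseteq> A" "D \<subseteq> B" for C D
    proof (cases "\<nu> C < 0 \<or> \<nu> D < 0")
      case True
      have "ennreal (\<nu> C) \<le> V (A \<union> B)" "ennreal (\<nu> D) \<le> V (A \<union> B)"
        using that by (auto intro!: le_V)
      with True show ?thesis by (auto simp: ennreal_neg)
    next
      case False
      then have "ennreal (\<nu> C) + ennreal (\<nu> D) = ennreal (\<nu> (C \<union> D))"
        using that AB by (subst nu2) (auto simp: ennreal_plus)
      also have "\<dots> \<le> V (A \<union> B)" using that by (intro le_V) auto
      finally show ?thesis .
    qed
    have ne: "{C \<in> \<Sigma>. C \<subseteq> A} \<noteq> {}" "{C \<in> \<Sigma>. C \<subseteq> B} \<noteq> {}" by auto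
    have "ennreal (\<nu> C) + V B \<le> V (A \<union> B)" if "C \<in> \<Sigma>" "C \<subseteq> A" for C
      unfolding V_def[of B] using that
      by (subst ennreal_SUP_add_right[OF ne(2)]) (auto intro!: SUP_least *)
    then have "(SUP C\<in>{C \<in> \<Sigma>. C \<subseteq> A}. ennreal (\<nu> C) + V B) \<le> V (A \<union> B)"
      by (intro SUP_least) auto
    then show ?thesis
      unfolding V_def[of A] by (subst ennreal_SUP_add_left[OF ne(1), symmetric])
  qed
  have "countably_additive \<Sigma> V"
  proof (rule countably_additiveI)
    fix A :: "nat \<Rightarrow> 'a set"
    assume A: "range A \<subseteq> \<Sigma>" "disjoint_family A"
    have fin: "(\<Sum>i<n. V (A i)) \<le> V (\<Union>i<n. A i)" for n
    proof (induction n)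
      case 0
      then show ?case by (simp add: V0)
    next
      case (Suc n)
      have "A i \<inter> A n = {}" if "i < n" for i
        using A(2) that by (intro disjoint_family_onD) auto
      then have "(\<Union>i<n. A i) \<inter> A n = {}" by blast
      then have "V (\<Union>i<n. A i) + V (A n) \<le> V ((\<Union>i<n. A i) \<union> A n)" by (rule V_super)
      moreover have "(\<Union>i<n. A i) \<union> A n = (\<Union>i<Suc n. A i)"
        by (simp add: lessThan_Suc Un_commute)
      moreover have "(\<Sum>i<Suc n. V (A i)) \<le> V (\<Union>i<n. A i) + V (A n)"
        using Suc by (simp add: add_right_mono)
      ultimately show ?case by (metis order_trans)
    qed
    have "(\<Sum>i. V (A i)) \<le> V (\<Union>i. A i)"
      unfolding suminf_eq_SUP
      by (intro SUP_least order_trans[OF fin] V_mono) auto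
    moreover have "V (\<Union>i. A i) \<le> (\<Sum>i. V (A i))"
      unfolding V_def[of "\<Union>i. A i"]
    proof (rule SUP_least)
      fix B assume B: "B \<in> {B \<in> \<Sigma>. B \<subseteq> (\<Union>i. A i)}"
      have "(\<lambda>i. \<nu> (B \<inter> A i)) sums \<nu> (\<Union>i. B \<inter> A i)"
        using A B by (intro ca) (auto simp: disjoint_family_on_def)
      also have "(\<Union>i. B \<inter> A i) = B" using B by auto
      finally have s: "(\<lambda>n. \<Sum>i<n. \<nu> (B \<inter> A i)) \<longlonglongrightarrow> \<nu> B" by (simp add: sums_def)
      have "ennreal (\<Sum>i<n. \<nu> (B \<inter> A i)) \<le> (\<Sum>i. V (A i))" for n
      proof -
        have "ennreal (\<Sum>i<n. \<nu> (B \<inter> A i)) \<le> ennreal (\<Sum>i<n. max 0 (\<nu> (B \<inter> A i)))"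
          by (intro ennreal_leI sum_mono) auto
        also have "\<dots> = (\<Sum>i<n. ennreal (max 0 (\<nu> (B \<inter> A i))))"
          by (rule sum_ennreal[symmetric]) simp
        also have "\<dots> = (\<Sum>i<n. ennreal (\<nu> (B \<inter> A i)))"
          by (intro sum.cong) (auto simp: max_def ennreal_neg)
        also have "\<dots> \<le> (\<Sum>i<n. V (A i))"
          using A B by (intro sum_mono le_V) auto
        also have "\<dots> \<le> (\<Sum>i. V (A i))"
          by (intro sum_le_suminf) auto
        finally show ?thesis .
      qed
      then show "ennreal (\<nu> B) \<le> (\<Sum>i. V (A i))"
        using tendsto_ennrealI[OF s] by (intro LIMSEQ_le_const2) auto
    qed
    ultimately show "(\<Sum>i. V (A i)) = V (\<Union>i. A i)" by (rule antisym)
  qed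
  moreover have "positive \<Sigma> V" by (simp add: positive_def V0)
  ultimately show ?thesis
    using X emeasure_measure_of_sigma[OF sa, of V X]
    by (simp add: upper_variation_def V_def[abs_def])
qed

text \<open>
  Integrability with respect to all four Jordan parts is the same as integrability
  with respect to the total variation of \<open>\<mu>\<close>.
\<close>

definition cm_integrable ::
    "'a set set \<Rightarrow> ('a set \<Rightarrow> complex) \<Rightarrow> ('a \<Rightarrow> complex) \<Rightarrow> bool" where
  "cm_integrable \<Sigma> \<mu> g \<longleftrightarrow>
     integrable (upper_variation \<Sigma> (\<lambda>A. Re (\<mu> A))) g \<and>
     integrable (upper_variation \<Sigma> (\<lambda>A. - Re (\<mu> A))) g \<and>
     integrable (upper_variation \<Sigma> (\<lambda>A. Im (\<mu> A))) g \<and>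
     integrable (upper_variation \<Sigma> (\<lambda>A. - Im (\<mu> A))) g"

definition cm_integral ::
    "'a set set \<Rightarrow> ('a set \<Rightarrow> complex) \<Rightarrow> ('a \<Rightarrow> complex) \<Rightarrow> complex" where
  "cm_integral \<Sigma> \<mu> g =
     (integral\<^sup>L (upper_variation \<Sigma> (\<lambda>A. Re (\<mu> A))) g
       - integral\<^sup>L (upper_variation \<Sigma> (\<lambda>A. - Re (\<mu> A))) g)
     + \<i> * (integral\<^sup>L (upper_variation \<Sigma> (\<lambda>A. Im (\<mu> A))) g
       - integral\<^sup>L (upper_variation \<Sigma> (\<lambda>A. - Im (\<mu> A))) g)"


section \<open>Exponentials and the functional equation\<close>

definition reflect :: "('a::ab_group_add \<Rightarrow> complex) \<Rightarrow> 'a \<Rightarrow> complex" where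
  "reflect f = (\<lambda>x. f (- x))"

definition even_fun :: "('a::ab_group_add \<Rightarrow> complex) \<Rightarrow> bool" where
  "even_fun f \<longleftrightarrow> reflect f = f"

definition exponential :: "('a::ab_group_add \<Rightarrow> complex) \<Rightarrow> bool" where
  "exponential m \<longleftrightarrow> m \<noteq> (\<lambda>x. 0) \<and> (\<forall>x y. m (x + y) = m x * m y)"

definition cm_hat ::
    "'a::ab_group_add set set \<Rightarrow> ('a set \<Rightarrow> complex) \<Rightarrow> ('a \<Rightarrow> complex) \<Rightarrow> complex" where
  "cm_hat \<Sigma> \<mu> m = cm_integral \<Sigma> \<mu> (reflect m)"

definition solves_equation ::
    "'a::ab_group_add set set \<Rightarrow> ('a set \<Rightarrow> complex) \<Rightarrow> ('a \<Rightarrow> complex) \<Rightarrow> ('a \<Rightarrow> complex) \<Rightarrow> bool"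
  where
  "solves_equation \<Sigma> \<mu> f k \<longleftrightarrow>
     (\<forall>x y. cm_integrable \<Sigma> \<mu> (\<lambda>t. f (x + y - t) + f (x - y + t)) \<and>
            cm_integral \<Sigma> \<mu> (\<lambda>t. f (x + y - t) + f (x - y + t)) = k x * f y)"

definition noneven_form ::
    "'a::ab_group_add set set \<Rightarrow> ('a set \<Rightarrow> complex) \<Rightarrow> ('a \<Rightarrow> complex) \<Rightarrow> complex \<Rightarrow>
     ('a \<Rightarrow> complex) \<Rightarrow> ('a \<Rightarrow> complex) \<Rightarrow> bool" where
  "noneven_form \<Sigma> \<mu> m \<alpha> f k \<longleftrightarrow>
     exponential m \<and> \<not> even_fun m \<and> \<alpha> \<noteq> 0 \<and>
     cm_integrable \<Sigma> \<mu> m \<and> cm_integrable \<Sigma> \<mu> (reflect m) \<and>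
     (\<forall>x. f x = \<alpha> * cm_hat \<Sigma> \<mu> m * m x + \<alpha> * cm_hat \<Sigma> \<mu> (reflect m) * m (- x)) \<and>
     (\<forall>x. k x = cm_hat \<Sigma> \<mu> m * m x + cm_hat \<Sigma> \<mu> (reflect m) * m (- x))"

definition even_form ::
    "'a::ab_group_add set set \<Rightarrow> ('a set \<Rightarrow> complex) \<Rightarrow> ('a \<Rightarrow> complex) \<Rightarrow> complex \<Rightarrow>
     ('a \<Rightarrow> complex) \<Rightarrow> ('a \<Rightarrow> complex) \<Rightarrow> bool" where
  "even_form \<Sigma> \<mu> m\<^sub>0 \<alpha> f k \<longleftrightarrow>
     exponential m\<^sub>0 \<and> even_fun m\<^sub>0 \<and> \<alpha> \<noteq> 0 \<and>
     cm_integrable \<Sigma> \<mu> m\<^sub>0 \<and> cm_hat \<Sigma> \<mu> m\<^sub>0 \<noteq> 0 \<and>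
     (\<forall>x. f x = 2 * \<alpha> * cm_hat \<Sigma> \<mu> m\<^sub>0 * m\<^sub>0 x) \<and>
     (\<forall>x. k x = 2 * cm_hat \<Sigma> \<mu> m\<^sub>0 * m\<^sub>0 x)"


section \<open>Topological groups and Haar measure\<close>

text \<open>
  The topology is an explicit object rather than a type class, so that it can be put on an
  arbitrary abelian group.  No separation axiom is imposed.  For locally compact
  groups the definitions below refer to closed compact sets; in the Hausdorff case
  these are just the compact sets.
\<close>

definition topological_ab_group :: "'a::ab_group_add topology \<Rightarrow> bool" where
  "topological_ab_group T \<longleftrightarrow> topspace T = UNIV \<and>
     continuous_map (prod_topology T T) T (\<lambda>(x, y). x + y) \<and>
     continuous_map T T (\<lambda>x. - x)"

definition closed_compact :: "'a topology \<Rightarrow> 'a set \<Rightarrow> bool" where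
  "closed_compact T K \<longleftrightarrow> compactin T K \<and> closedin T K"

definition haar_measure :: "'a::ab_group_add topology \<Rightarrow> 'a measure \<Rightarrow> bool" where
  "haar_measure T \<eta> \<longleftrightarrow>
     space \<eta> = UNIV \<and> sets \<eta> = sigma_sets UNIV {U. openin T U} \<and>
     emeasure \<eta> UNIV \<noteq> 0 \<and>
     (\<forall>a. \<forall>A \<in> sets \<eta>. emeasure \<eta> ((\<lambda>x. a + x) ` A) = emeasure \<eta> A) \<and>
     (\<forall>K. closed_compact T K \<longrightarrow> emeasure \<eta> K < \<infinity>) \<and>
     (\<forall>A \<in> sets \<eta>. emeasure \<eta> A = (INF U\<in>{U. openin T U \<and> A \<subseteq> U}. emeasure \<eta> U)) \<and>
     (\<forall>U. openin T U \<longrightarrow>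
        emeasure \<eta> U = (SUP K\<in>{K. closed_compact T K \<and> K \<subseteq> U}. emeasure \<eta> K))"

text \<open>
  Measurability and null sets are understood locally, as is usual for Haar measures that
  are not \<open>\<sigma>\<close>-finite.  Functions that are measurable with respect to the completion, or
  bounded almost everywhere, satisfy these conditions in particular.
\<close>

definition haar_measurable ::
    "'a topology \<Rightarrow> 'a measure \<Rightarrow> ('a \<Rightarrow> complex) \<Rightarrow> bool" where
  "haar_measurable T \<eta> f \<longleftrightarrow>
     (\<forall>K. closed_compact T K \<longrightarrow> f \<in> borel_measurable (restrict_space (completion \<eta>) K))"

definition ess_bounded ::
    "'a topology \<Rightarrow> 'a measure \<Rightarrow> ('a \<Rightarrow> complex) \<Rightarrow> bool" where
  "ess_bounded T \<eta> f \<longleftrightarrow>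
     (\<exists>C. \<forall>K. closed_compact T K \<longrightarrow> (AE x in \<eta>. x \<in> K \<longrightarrow> cmod (f x) \<le> C))"

definition character :: "'a::ab_group_add topology \<Rightarrow> ('a \<Rightarrow> complex) \<Rightarrow> bool" where
  "character T m \<longleftrightarrow> continuous_map T euclidean m \<and>
     (\<forall>x y. m (x + y) = m x * m y) \<and> (\<forall>x. cmod (m x) = 1)"

end

theory Submission
  imports Defs
begin

text \<open>
  Write \<open>g\<^sub>x s = f (x + s) + f (x - s)\<close>.  The equation says that the convolution of \<open>g\<^sub>x\<close> with
  \<open>\<mu>\<close> is \<open>k x * f\<close>.  Since \<open>g\<^sub>x (s + z) + g\<^sub>x (s - z)\<close> is symmetric under exchanging the shift of
  \<open>s\<close> with a shift of \<open>x\<close>, the measure drops out and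
  \<open>(k (x + z) + k (x - z)) * f y = k x * (f (y + z) + f (y - z))\<close> remains (\<open>translation_symmetry\<close>).
  So \<open>f\<close> satisfies \<open>f (y + z) + f (y - z) = 2 * f y * C z\<close>, where \<open>C\<close> solves the equation of
  d'Alembert and hence is the even part \<open>(m + reflect m) / 2\<close> of an exponential \<open>m\<close>
  (\<open>dAlembert_solution\<close>).  Inserting this into the original equation turns the integrand into
  \<open>2 * f x * C (y - t)\<close>; hence \<open>f\<close> is proportional to \<open>k\<close>, and \<open>k\<close> is the convolution of
  \<open>2 * C\<close> with \<open>\<mu>\<close>, which is the asserted form (\<open>solution_as_convolution\<close>, \<open>solution_forms\<close>).
  The converse is a computation with the multiplicativity of \<open>m\<close>.

  For the regularity statements, \<open>m\<close> or its reflection is a linear combination of translates of the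
  given regular function (\<open>exponential_from_translates\<close>).  This settles continuity at once and
  reduces the measurable case to a single exponential.  A measurable exponential is nearly constant on
  some set of positive finite Haar measure, and the differences of the elements of such a set fill a
  neighbourhood of \<open>0\<close> (\<open>Steinhaus\<close>), so that it is continuous at \<open>0\<close> and therefore everywhere.
  An exponential with a value of modulus greater than \<open>1\<close> grows geometrically along the multiples
  of one element, which is incompatible with essential boundedness; applied to an element and to its
  negative, this makes a bounded exponential a character.
\<close>


section \<open>Linearity of the integral\<close>

lemma cm_integrable_add:
  "cm_integrable \<Sigma> \<mu> g \<Longrightarrow> cm_integrable \<Sigma> \<mu> h \<Longrightarrow> cm_integrable \<Sigma> \<mu> (\<lambda>t. g t + h t)"
  by (simp add: cm_integrable_def)

lemma cm_integral_add:
  "cm_integrable \<Sigma> \<mu> g \<Longrightarrow> cm_integrable \<Sigma> \<mu> h \<Longrightarrow>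
    cm_integral \<Sigma> \<mu> (\<lambda>t. g t + h t) = cm_integral \<Sigma> \<mu> g + cm_integral \<Sigma> \<mu> h"
  by (simp add: cm_integrable_def cm_integral_def algebra_simps)

lemma cm_integrable_mult_right:
  "cm_integrable \<Sigma> \<mu> g \<Longrightarrow> cm_integrable \<Sigma> \<mu> (\<lambda>t. c * g t)"
  by (simp add: cm_integrable_def)

lemma cm_integral_mult_right:
  "cm_integral \<Sigma> \<mu> (\<lambda>t. c * g t) = c * cm_integral \<Sigma> \<mu> g"
  by (simp add: cm_integral_def algebra_simps)

lemma cm_integrable_cancel:
  assumes "cm_integrable \<Sigma> \<mu> (\<lambda>t. c * g t)" "c \<noteq> 0"
  shows "cm_integrable \<Sigma> \<mu> g"
  using cm_integrable_mult_right[OF assms(1), of "inverse c"] assms(2)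
  by (simp add: mult.assoc[symmetric])


section \<open>Exponentials\<close>

lemma exponential_add: "exponential m \<Longrightarrow> m (x + y) = m x * m y"
  by (simp add: exponential_def)

lemma exponential_zero: "exponential m \<Longrightarrow> m 0 = 1"
proof -
  assume m: "exponential m"
  then obtain x where "m x \<noteq> 0" unfolding exponential_def fun_eq_iff by blast
  with exponential_add[OF m, of x 0] show "m 0 = 1" by simp
qed

lemma exponential_minus_mult: "exponential m \<Longrightarrow> m (- x) * m x = 1"
  using exponential_add[of m "- x" x] exponential_zero[of m] by simp

lemma exponential_nonzero: "exponential m \<Longrightarrow> m x \<noteq> 0"
  using exponential_minus_mult[of m x] by auto

lemma exponential_diff: "exponential m \<Longrightarrow> m (x - y) = m x * m (- y)"
  using exponential_add[of m x "- y"] by simp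

lemma exponential_of_nat: "exponential m \<Longrightarrow> m (((+) a ^^ n) x) = m a ^ n * m x"
  by (induction n) (auto simp: exponential_add)

lemma exponential_reflect: "exponential m \<Longrightarrow> exponential (reflect m)"
proof -
  assume m: "exponential m"
  have "m (- (x + y)) = m (- x) * m (- y)" for x y
    using exponential_add[OF m, of "- x" "- y"] by simp
  moreover have "reflect m \<noteq> (\<lambda>x. 0)"
    using exponential_nonzero[OF m, of "- 0"] by (metis reflect_def)
  ultimately show "exponential (reflect m)" by (simp add: exponential_def reflect_def)
qed


section \<open>The equation of d'Alembert\<close>

text \<open>
  For \<open>C = cosh\<close> the exponential is recovered as \<open>cosh x + sinh x\<close>, with
  \<open>sinh x = (cosh (x + a) - cosh (x - a)) / (2 * sinh a)\<close>.  The same formula works on any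
  abelian group as soon as some \<open>a\<close> has \<open>C a ^ 2 \<noteq> 1\<close>, a square root of \<open>C a ^ 2 - 1\<close> playing
  the part of \<open>sinh a\<close>; no element of the group has to be halved.  If there is no such \<open>a\<close>,
  then \<open>C\<close> takes only the values \<open>1\<close> and \<open>- 1\<close>, which forces \<open>C (x + y) = C (x - y)\<close>, and
  \<open>C\<close> itself is an exponential.
\<close>

lemma dAlembert_solution:
  fixes C :: "'a::ab_group_add \<Rightarrow> complex"
  assumes dA: "\<And>x y. C (x + y) + C (x - y) = 2 * C x * C y" and C0: "C 0 = 1"
  obtains m where "exponential m" "\<And>x. C x = (m x + m (- x)) / 2"
proof -
  have even: "C (- x) = C x" for x using dA[of 0 x] C0 by simp
  show thesis
  proof (cases "\<forall>x. (C x)\<^sup>2 = 1")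
    case True
    have pm: "C x = 1 \<or> C x = - 1" for x using True power2_eq_1_iff by blast
    have "C (x + y) = C x * C y" for x y
      using dA[of x y] pm[of x] pm[of y] pm[of "x + y"] pm[of "x - y"] by auto
    then have "exponential C" using C0 by (auto simp: exponential_def fun_eq_iff intro!: exI[of _ 0])
    then show thesis by (rule that) (simp add: even)
  next
    case False
    then obtain a where a: "(C a)\<^sup>2 \<noteq> 1" by auto
    define s where "s = csqrt ((C a)\<^sup>2 - 1)"
    have s2: "s\<^sup>2 = (C a)\<^sup>2 - 1" by (simp add: s_def)
    have s0: "s \<noteq> 0" using a by (simp add: s_def)
    define S where "S x = (C (x + a) - C (x - a)) / (2 * s)" for x
    have S_odd: "S (- x) = - S x" for x
    proof -
      have "C (- x + a) = C (x - a)" "C (- x - a) = C (x + a)"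
        using even[of "x - a"] even[of "x + a"] by simp_all
      then show ?thesis by (simp add: S_def minus_divide_left)
    qed
    have S_plus: "S (x + y) + S (x - y) = 2 * S x * C y" for x y
    proof -
      have 1: "C (x + y + a) + C (x - y + a) = 2 * C (x + a) * C y"
        using dA[of "x + a" y] by (simp add: algebra_simps)
      have 2: "C (x + y - a) + C (x - y - a) = 2 * C (x - a) * C y"
        using dA[of "x - a" y] by (simp add: algebra_simps)
      have "2 * s * (S (x + y) + S (x - y)) =
          (C (x + y + a) + C (x - y + a)) - (C (x + y - a) + C (x - y - a))"
        using s0 by (simp add: S_def field_simps)
      also have "\<dots> = 2 * s * (2 * S x * C y)"
        unfolding 1 2 using s0 by (simp add: S_def field_simps)
      finally show ?thesis using s0 by (metis mult_eq_0_iff mult_left_cancel zero_neq_numeral)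
    qed
    have S_add: "S (x + y) = S x * C y + C x * S y" for x y
    proof -
      have "2 * S (x + y) = (S (x + y) + S (x - y)) + (S (y + x) + S (y - x))"
        using S_odd[of "x - y"] by (simp add: add.commute)
      also have "\<dots> = 2 * (S x * C y + C x * S y)" unfolding S_plus by simp
      finally show ?thesis by (metis mult_left_cancel zero_neq_numeral)
    qed
    have S_mult: "2 * S x * S y = C (x + y) - C (x - y)" for x y
    proof -
      have C2a: "C (a + a) = 2 * s\<^sup>2 + 1"
        unfolding s2 using dA[of a a] C0 by (simp add: power2_eq_square algebra_simps)
      have 1: "2 * C (x + a) * C (y + a) = C (x + y + (a + a)) + C (x - y)"
        using dA[of "x + a" "y + a"] by (simp add: algebra_simps)
      have 2: "2 * C (x - a) * C (y - a) = C (x + y - (a + a)) + C (x - y)"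
        using dA[of "x - a" "y - a"] by (simp add: algebra_simps)
      have 3: "2 * C (x + a) * C (y - a) = C (x + y) + C (x - y + (a + a))"
        using dA[of "x + a" "y - a"] by (simp add: algebra_simps)
      have 4: "2 * C (x - a) * C (y + a) = C (x + y) + C (x - y - (a + a))"
        using dA[of "x - a" "y + a"] by (simp add: algebra_simps)
      have "4 * s\<^sup>2 * (2 * S x * S y) =
          2 * C (x + a) * C (y + a) + 2 * C (x - a) * C (y - a)
            - 2 * C (x + a) * C (y - a) - 2 * C (x - a) * C (y + a)"
        using s0 by (simp add: S_def field_simps power2_eq_square)
      also have "\<dots> = (C (x + y + (a + a)) + C (x + y - (a + a)))
            - (C (x - y + (a + a)) + C (x - y - (a + a))) + 2 * C (x - y) - 2 * C (x + y)"
        unfolding 1 2 3 4 by simp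
      also have "\<dots> = 4 * s\<^sup>2 * (C (x + y) - C (x - y))"
        unfolding dA C2a by (simp add: algebra_simps)
      finally show ?thesis
        using s0 by (metis mult_eq_0_iff mult_left_cancel power_eq_0_iff zero_neq_numeral)
    qed
    define m where "m x = C x + S x" for x
    have "m (x + y) = m x * m y" for x y
    proof -
      have "2 * (C x * C y + S x * S y) = 2 * C (x + y)"
      proof -
        have "2 * (C x * C y + S x * S y) = 2 * C x * C y + 2 * S x * S y"
          by (simp add: algebra_simps)
        also have "\<dots> = 2 * C (x + y)"
          unfolding S_mult dA[symmetric] by simp
        finally show ?thesis .
      qed
      then have "C x * C y + S x * S y = C (x + y)" by (metis mult_left_cancel zero_neq_numeral)
      then show ?thesis using S_add[of x y] by (simp add: m_def algebra_simps)
    qed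
    moreover have "m 0 \<noteq> 0"
      using C0 even[of a] by (simp add: m_def S_def)
    ultimately have "exponential m" by (auto simp: exponential_def fun_eq_iff)
    then show thesis
      by (rule that) (simp add: m_def even S_odd)
  qed
qed


section \<open>The solutions\<close>

text \<open>
  With \<open>g\<^sub>x s = f (x + s) + f (x - s)\<close> the equation says that the convolution of \<open>g\<^sub>x\<close> with
  \<open>\<mu>\<close> is \<open>k x * f\<close>.  Both \<open>g\<^sub>x (s + z) + g\<^sub>x (s - z)\<close> and \<open>g\<^sub>x\<^sub>+\<^sub>z s + g\<^sub>x\<^sub>-\<^sub>z s\<close> are the sum
  of the same four values of \<open>f\<close>, so their convolutions agree.
\<close>

lemma translation_symmetry:
  assumes "solves_equation \<Sigma> \<mu> f k"
  shows "(k (x + z) + k (x - z)) * f y = k x * (f (y + z) + f (y - z))"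
proof -
  define G where "G x y = (\<lambda>t. f (x + y - t) + f (x - y + t))" for x y
  have int: "cm_integrable \<Sigma> \<mu> (G x y)" and eq: "cm_integral \<Sigma> \<mu> (G x y) = k x * f y" for x y
    using assms by (auto simp: solves_equation_def G_def)
  have "cm_integral \<Sigma> \<mu> (\<lambda>t. G (x + z) y t + G (x - z) y t) =
      cm_integral \<Sigma> \<mu> (\<lambda>t. G x (y + z) t + G x (y - z) t)"
    by (rule arg_cong[of _ _ "cm_integral \<Sigma> \<mu>"]) (auto simp: G_def fun_eq_iff algebra_simps)
  then show ?thesis
    by (simp add: cm_integral_add int eq algebra_simps)
qed

text \<open>
  The symmetry, divided by a nonzero value of \<open>k\<close>, is the equation of Wilson for \<open>f\<close>, and its
  cosine function \<open>C\<close> satisfies the equation of d'Alembert.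
\<close>

lemma Wilson_equation:
  assumes sol: "solves_equation \<Sigma> \<mu> f k" and f0: "f \<noteq> (\<lambda>x. 0)" and k0: "k \<noteq> (\<lambda>x. 0)"
  obtains m where "exponential m" "\<And>y z. f (y + z) + f (y - z) = f y * (m z + m (- z))"
proof -
  obtain x\<^sub>0 y\<^sub>0 where x0: "k x\<^sub>0 \<noteq> 0" and y0: "f y\<^sub>0 \<noteq> 0" using f0 k0 by (auto simp: fun_eq_iff)
  define C where "C z = (k (x\<^sub>0 + z) + k (x\<^sub>0 - z)) / (2 * k x\<^sub>0)" for z
  have W: "f (y + z) + f (y - z) = 2 * f y * C z" for y z
  proof -
    have "k x\<^sub>0 * (f (y + z) + f (y - z)) = k x\<^sub>0 * (2 * f y * C z)"
      using translation_symmetry[OF sol, of x\<^sub>0 z y] x0 by (simp add: C_def mult.commute)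
    then show ?thesis using x0 by simp
  qed
  have dA: "C (z + w) + C (z - w) = 2 * C z * C w" for z w
  proof -
    have "2 * f y\<^sub>0 * (C (z + w) + C (z - w)) =
        (f (y\<^sub>0 + z + w) + f (y\<^sub>0 + z - w)) + (f (y\<^sub>0 - z + w) + f (y\<^sub>0 - z - w))"
    proof -
      have "2 * f y\<^sub>0 * (C (z + w) + C (z - w)) =
          (f (y\<^sub>0 + (z + w)) + f (y\<^sub>0 - (z + w))) + (f (y\<^sub>0 + (z - w)) + f (y\<^sub>0 - (z - w)))"
        unfolding W by (simp only: distrib_left)
      then show ?thesis by (simp add: algebra_simps)
    qed
    also have "\<dots> = 2 * (f (y\<^sub>0 + z) + f (y\<^sub>0 - z)) * C w"
      unfolding W[of "y\<^sub>0 + z" w] W[of "y\<^sub>0 - z" w] by (simp add: algebra_simps)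
    also have "\<dots> = 2 * f y\<^sub>0 * (2 * C z * C w)" unfolding W by simp
    finally show ?thesis using y0 by (metis mult_eq_0_iff mult_left_cancel zero_neq_numeral)
  qed
  have C0: "C 0 = 1" using x0 by (simp add: C_def)
  obtain m where m: "exponential m" "\<And>x. C x = (m x + m (- x)) / 2"
    using dAlembert_solution[of C, OF dA C0] by blast
  show thesis
  proof (rule that[OF m(1)])
    fix y z show "f (y + z) + f (y - z) = f y * (m z + m (- z))"
      unfolding W m(2) by simp
  qed
qed

text \<open>
  Wilson's equation turns the integrand into \<open>f x * (m (y - t) + m (t - y))\<close>.  Hence
  \<open>f x * h y = k x * f y\<close>, where \<open>h\<close> is the convolution of \<open>m + reflect m\<close> with \<open>\<mu>\<close>.  This
  makes \<open>f\<close> and \<open>k\<close> multiples of each other and identifies \<open>k\<close> with \<open>h\<close>.  In particular the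
  solutions \<open>m * (c + a)\<close> of Wilson's equation, with \<open>m\<close> even and a nonzero additive function
  \<open>a\<close>, do not occur.
\<close>

lemma solution_as_convolution:
  assumes sol: "solves_equation \<Sigma> \<mu> f k" and f0: "f \<noteq> (\<lambda>x. 0)" and k0: "k \<noteq> (\<lambda>x. 0)"
  obtains m \<alpha> where "exponential m" "\<alpha> \<noteq> 0" "\<And>x. f x = \<alpha> * k x"
    "\<And>y. cm_integrable \<Sigma> \<mu> (\<lambda>t. m y * m (- t) + m (- y) * m t)"
    "\<And>y. k y = cm_integral \<Sigma> \<mu> (\<lambda>t. m y * m (- t) + m (- y) * m t)"
proof -
  obtain m where m: "exponential m" and
    W: "\<And>y z. f (y + z) + f (y - z) = f y * (m z + m (- z))"
    using Wilson_equation[OF assms] by blast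
  obtain x\<^sub>0 y\<^sub>0 where x0: "k x\<^sub>0 \<noteq> 0" and y0: "f y\<^sub>0 \<noteq> 0" using f0 k0 by (auto simp: fun_eq_iff)
  define G where "G y = (\<lambda>t. m y * m (- t) + m (- y) * m t)" for y
  have G: "f (x + y - t) + f (x - y + t) = f x * G y t" for x y t
  proof -
    have "f (x + y - t) + f (x - y + t) = f (x + (y - t)) + f (x - (y - t))"
      by (simp add: algebra_simps)
    also have "\<dots> = f x * (m (y - t) + m (- y + t))" unfolding W by simp
    finally show ?thesis unfolding exponential_add[OF m] exponential_diff[OF m] G_def .
  qed
  have int: "cm_integrable \<Sigma> \<mu> (\<lambda>t. f x * G y t)"
    and eq: "f x * cm_integral \<Sigma> \<mu> (G y) = k x * f y" for x y
    using sol by (simp_all add: solves_equation_def G flip: cm_integral_mult_right)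
  have intG: "cm_integrable \<Sigma> \<mu> (G y)" for y
    using cm_integrable_cancel[OF int y0] .
  define \<alpha> where "\<alpha> = f y\<^sub>0 / k y\<^sub>0"
  have ky0: "k y\<^sub>0 \<noteq> 0"
    using eq[of x\<^sub>0 y\<^sub>0] eq[of y\<^sub>0 y\<^sub>0] x0 y0 by auto
  have h: "f y = \<alpha> * cm_integral \<Sigma> \<mu> (G y)" for y
    using eq[of y\<^sub>0 y] ky0 by (simp add: \<alpha>_def field_simps)
  have \<alpha>0: "\<alpha> \<noteq> 0" using y0 ky0 by (simp add: \<alpha>_def)
  have "f x * f y\<^sub>0 = \<alpha> * k x * f y\<^sub>0" for x
    using eq[of x y\<^sub>0] h[of y\<^sub>0] \<alpha>0 by (simp add: algebra_simps)
  then have fk: "f x = \<alpha> * k x" for x using y0 by simp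
  have "k y = cm_integral \<Sigma> \<mu> (G y)" for y using h[of y] fk[of y] \<alpha>0 by simp
  then show thesis
    using that[OF m \<alpha>0 fk] intG by (simp add: G_def)
qed

lemma solution_forms:
  assumes sol: "solves_equation \<Sigma> \<mu> f k" and f0: "f \<noteq> (\<lambda>x. 0)" and k0: "k \<noteq> (\<lambda>x. 0)"
  shows "(\<exists>m \<alpha>. noneven_form \<Sigma> \<mu> m \<alpha> f k) \<or> (\<exists>m\<^sub>0 \<alpha>. even_form \<Sigma> \<mu> m\<^sub>0 \<alpha> f k)"
proof -
  obtain m \<alpha> where m: "exponential m" and \<alpha>: "\<alpha> \<noteq> 0" and fk: "\<And>x. f x = \<alpha> * k x"
    and int: "\<And>y. cm_integrable \<Sigma> \<mu> (\<lambda>t. m y * m (- t) + m (- y) * m t)"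
    and k: "\<And>y. k y = cm_integral \<Sigma> \<mu> (\<lambda>t. m y * m (- t) + m (- y) * m t)"
    by (rule solution_as_convolution[OF assms]) (rule that)
  show ?thesis
  proof (cases "even_fun m")
    case True
    then have ev: "m (- x) = m x" for x by (auto simp: even_fun_def reflect_def fun_eq_iff)
    then have r: "reflect m = m" by (simp add: reflect_def)
    have "cm_integrable \<Sigma> \<mu> (\<lambda>t. 2 * m t)"
      using int[of 0] by (simp add: ev exponential_zero[OF m])
    then have im: "cm_integrable \<Sigma> \<mu> m" by (rule cm_integrable_cancel) simp
    have k': "k y = 2 * cm_hat \<Sigma> \<mu> m * m y" for y
    proof -
      have "(\<lambda>t. m y * m (- t) + m (- y) * m t) = (\<lambda>t. (2 * m y) * m t)"
        by (simp add: ev fun_eq_iff algebra_simps)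
      then show ?thesis
        unfolding k cm_hat_def r by (simp only: cm_integral_mult_right) (simp add: mult_ac)
    qed
    have "cm_hat \<Sigma> \<mu> m \<noteq> 0" using k' k0 by (auto simp: fun_eq_iff)
    then have "even_form \<Sigma> \<mu> m \<alpha> f k"
      unfolding even_form_def using m \<alpha> True im by (simp add: fk k')
    then show ?thesis by blast
  next
    case False
    then obtain a where a: "m (- a) \<noteq> m a" by (auto simp: even_fun_def reflect_def fun_eq_iff)
    \<comment> \<open>The sum at \<open>y = 0\<close> and at \<open>y = a\<close> gives two independent combinations of \<open>m\<close> and its
      reflection, so that each of them is integrable by itself.\<close>
    have "cm_integrable \<Sigma> \<mu>
        (\<lambda>t. (m a * m (- t) + m (- a) * m t) + (- m (- a)) * (m 0 * m (- t) + m (- 0) * m t))"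
      by (intro cm_integrable_add cm_integrable_mult_right int)
    then have "cm_integrable \<Sigma> \<mu> (\<lambda>t. (m a - m (- a)) * m (- t))"
      by (simp add: exponential_zero[OF m] algebra_simps)
    then have i1: "cm_integrable \<Sigma> \<mu> (\<lambda>t. m (- t))"
      by (rule cm_integrable_cancel) (use a in auto)
    have "cm_integrable \<Sigma> \<mu> (\<lambda>t. (m 0 * m (- t) + m (- 0) * m t) + (- 1) * m (- t))"
      by (intro cm_integrable_add cm_integrable_mult_right int i1)
    then have i2: "cm_integrable \<Sigma> \<mu> m"
      by (simp add: exponential_zero[OF m])
    have k': "k y = cm_hat \<Sigma> \<mu> m * m y + cm_hat \<Sigma> \<mu> (reflect m) * m (- y)" for y
      unfolding k cm_hat_def reflect_def
      by (simp add: cm_integral_mult_right cm_integral_add i1 i2 cm_integrable_mult_right)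
    have "noneven_form \<Sigma> \<mu> m \<alpha> f k"
      unfolding noneven_form_def
      using m \<alpha> False i1 i2 by (auto simp: fk k' reflect_def algebra_simps)
    then show ?thesis by blast
  qed
qed

lemma noneven_form_solves:
  assumes "noneven_form \<Sigma> \<mu> m \<alpha> f k"
  shows "solves_equation \<Sigma> \<mu> f k"
proof -
  have m: "exponential m" and i2: "cm_integrable \<Sigma> \<mu> m" and i1: "cm_integrable \<Sigma> \<mu> (\<lambda>t. m (- t))"
    and f: "f x = \<alpha> * cm_hat \<Sigma> \<mu> m * m x + \<alpha> * cm_hat \<Sigma> \<mu> (reflect m) * m (- x)"
    and k: "k x = cm_hat \<Sigma> \<mu> m * m x + cm_hat \<Sigma> \<mu> (reflect m) * m (- x)" for x
    using assms by (auto simp: noneven_form_def reflect_def)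
  have G: "f (x + y - t) + f (x - y + t) = (\<alpha> * k x) * (m y * m (- t) + m (- y) * m t)" for x y t
  proof -
    have "m (- (x + y - t)) = m (- x) * m (- y) * m t"
      using exponential_add[OF m, of "- x + - y" t] exponential_add[OF m, of "- x" "- y"]
      by (simp add: algebra_simps)
    moreover have "m (- (x - y + t)) = m (- x) * m y * m (- t)"
      using exponential_add[OF m, of "- x + y" "- t"] exponential_add[OF m, of "- x" y]
      by (simp add: algebra_simps)
    ultimately show ?thesis
      unfolding f k by (simp add: exponential_add[OF m] exponential_diff[OF m] algebra_simps)
  qed
  have "cm_integral \<Sigma> \<mu> (\<lambda>t. m y * m (- t) + m (- y) * m t) = k y" for y
    by (simp add: cm_integrable_mult_right i1 i2 cm_integral_mult_right cm_integral_add
        k cm_hat_def reflect_def)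
  moreover have "f y = \<alpha> * k y" for y by (simp add: f k algebra_simps)
  ultimately show ?thesis
    unfolding solves_equation_def G
    by (simp add: cm_integrable_mult_right cm_integrable_add i1 i2 cm_integral_mult_right)
qed

lemma even_form_solves:
  assumes "even_form \<Sigma> \<mu> m \<alpha> f k"
  shows "solves_equation \<Sigma> \<mu> f k"
proof -
  have m: "exponential m" and i: "cm_integrable \<Sigma> \<mu> m" and r: "reflect m = m"
    and f: "f x = 2 * \<alpha> * cm_hat \<Sigma> \<mu> m * m x"
    and k: "k x = 2 * cm_hat \<Sigma> \<mu> m * m x" for x
    using assms by (auto simp: even_form_def even_fun_def)
  have ev: "m (- x) = m x" for x using r by (auto simp: reflect_def fun_eq_iff)
  have G: "f (x + y - t) + f (x - y + t) = (2 * \<alpha> * k x * m y) * m t" for x y t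
    unfolding f k by (simp add: exponential_add[OF m] exponential_diff[OF m] ev)
  show ?thesis
    unfolding solves_equation_def G
    by (auto simp: cm_integrable_mult_right i cm_integral_mult_right f cm_hat_def r)
qed


section \<open>Recovering the exponential from a solution\<close>

text \<open>
  What the two forms of the solutions have in common; the regularity arguments do not distinguish
  between them, the case of an even \<open>m\<close> being included with \<open>B = 0\<close>.
\<close>

definition exponential_pair ::
    "('a::ab_group_add \<Rightarrow> complex) \<Rightarrow> ('a \<Rightarrow> complex) \<Rightarrow> ('a \<Rightarrow> complex) \<Rightarrow> bool" where
  "exponential_pair m f k \<longleftrightarrow> exponential m \<and>
     (\<exists>A B \<alpha>. \<alpha> \<noteq> 0 \<and> k = (\<lambda>x. A * m x + B * m (- x)) \<and> f = (\<lambda>x. \<alpha> * k x))"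

lemma exponential_pairI:
  assumes "exponential m" "\<alpha> \<noteq> 0" "\<And>x. k x = A * m x + B * m (- x)" "\<And>x. f x = \<alpha> * k x"
  shows "exponential_pair m f k"
  using assms unfolding exponential_pair_def by blast

lemma noneven_form_pair: "noneven_form \<Sigma> \<mu> m \<alpha> f k \<Longrightarrow> exponential_pair m f k"
  unfolding noneven_form_def
  by (rule exponential_pairI[of m \<alpha> k "cm_hat \<Sigma> \<mu> m" "cm_hat \<Sigma> \<mu> (reflect m)"])
    (simp_all add: algebra_simps)

lemma even_form_pair: "even_form \<Sigma> \<mu> m \<alpha> f k \<Longrightarrow> exponential_pair m f k"
  unfolding even_form_def
  by (rule exponential_pairI[of m \<alpha> k "2 * cm_hat \<Sigma> \<mu> m" 0]) simp_all

text \<open>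
  If \<open>m a \<noteq> m (- a)\<close> and \<open>g = A * m + B * reflect m\<close>, then \<open>g (x + a) - m (- a) * g x\<close>
  equals \<open>A * (m a - m (- a)) * m x\<close>.  So \<open>m\<close> inherits from \<open>g\<close> every regularity property \<open>R\<close>
  that is stable under translations and linear combinations, unless \<open>A = 0\<close>, and then
  \<open>reflect m\<close> does.  The alternative in the conclusion lets the argument proceed by translations alone;
  so for Haar measure it rests on the defining invariance and not on the derived invariance under
  \<open>x \<mapsto> - x\<close>.
\<close>

lemma exponential_from_translates:
  assumes trans: "\<And>g a. R g \<Longrightarrow> R (\<lambda>x. g (x + a))"
    and lin: "\<And>g h c d. R g \<Longrightarrow> R h \<Longrightarrow> R (\<lambda>x. c * g x + d * h x :: complex)"
    and pair: "exponential_pair m f k" and nz: "k \<noteq> (\<lambda>x. 0)" and R: "R f \<or> R k"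
  shows "R m \<or> R (reflect m)"
proof -
  obtain A B \<alpha> where m: "exponential m" and \<alpha>: "\<alpha> \<noteq> 0"
    and k: "k = (\<lambda>x. A * m x + B * m (- x))" and f: "f = (\<lambda>x. \<alpha> * k x)"
    using pair unfolding exponential_pair_def by blast
  have Rk: "R k"
    using R
  proof
    assume "R f"
    from lin[OF this this, of "1 / \<alpha>" 0] show ?thesis using \<alpha> by (simp add: f)
  qed
  show ?thesis
  proof (cases "even_fun m")
    case True
    then have "k = (\<lambda>x. (A + B) * m x)"
      by (auto simp: k even_fun_def reflect_def fun_eq_iff algebra_simps)
    moreover from this have "A + B \<noteq> 0" using nz by auto
    ultimately show ?thesis
      using lin[OF Rk Rk, of "1 / (A + B)" 0] by simp
  next
    case False
    then obtain a where a: "m a \<noteq> m (- a)" by (force simp: even_fun_def reflect_def fun_eq_iff)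
    show ?thesis
    proof (cases "A = 0")
      case True
      then have "B \<noteq> 0" using nz by (auto simp: k)
      then show ?thesis
        using lin[OF Rk Rk, of "1 / B" 0] True by (simp add: k reflect_def)
    next
      case A: False
      define c where "c = A * (m a - m (- a))"
      have c0: "c \<noteq> 0" using a A by (simp add: c_def)
      have m_neg: "m (- (x + a)) = m (- x) * m (- a)" for x
        using exponential_add[OF m, of "- x" "- a"] by simp
      have "k (x + a) - m (- a) * k x = c * m x" for x
        unfolding k c_def exponential_add[OF m, of x a] m_neg
        by (simp add: algebra_simps)
      then have "m = (\<lambda>x. (1 / c) * k (x + a) + (- m (- a) / c) * k x)"
        using c0 by (auto simp: fun_eq_iff field_simps)
      with lin[OF trans[OF Rk, of a] Rk, of "1 / c" "- m (- a) / c"] show ?thesis by simp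
    qed
  qed
qed


section \<open>Continuity\<close>

lemma topological_ab_groupD:
  assumes "topological_ab_group T"
  shows "topspace T = UNIV"
    and "continuous_map (prod_topology T T) T (\<lambda>(x, y). x + y)"
    and "continuous_map T T (\<lambda>x. x + a)" and "continuous_map T T (\<lambda>x. a + x)"
    and "continuous_map T T (\<lambda>x. - x)"
proof -
  show top: "topspace T = UNIV"
    and add: "continuous_map (prod_topology T T) T (\<lambda>(x, y). x + y)"
    and "continuous_map T T (\<lambda>x. - x)"
    using assms by (auto simp: topological_ab_group_def)
  have p: "continuous_map T (prod_topology T T) (\<lambda>x. (x, a))"
    using top by (intro continuous_map_pairedI) auto
  show "continuous_map T T (\<lambda>x. x + a)"
    using continuous_map_compose[OF p add] by (simp add: o_def)
  then show "continuous_map T T (\<lambda>x. a + x)" by (simp add: add.commute)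
qed

lemma continuous_map_translate:
  "topological_ab_group T \<Longrightarrow> continuous_map T X g \<Longrightarrow> continuous_map T X (\<lambda>x. g (x + a))"
  using continuous_map_compose[OF topological_ab_groupD(3)] by (fastforce simp: o_def)

lemma continuous_map_reflect:
  "topological_ab_group T \<Longrightarrow> continuous_map T X (\<lambda>x. g (- x)) \<longleftrightarrow> continuous_map T X g"
  using continuous_map_compose[OF topological_ab_groupD(5), of T X g]
    continuous_map_compose[OF topological_ab_groupD(5), of T X "\<lambda>x. g (- x)"]
  by (auto simp: o_def)

lemma continuous_map_lincomb:
  fixes g h :: "'a \<Rightarrow> complex"
  assumes "continuous_map T euclidean g" "continuous_map T euclidean h"
  shows "continuous_map T euclidean (\<lambda>x. c * g x + d * h x)"
  using assms unfolding continuous_map_atin by (auto intro!: tendsto_intros)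

lemma exponential_pair_continuous:
  assumes T: "topological_ab_group T" and pair: "exponential_pair m f k"
    and m: "continuous_map T euclidean m"
  shows "continuous_map T euclidean f" "continuous_map T euclidean k"
proof -
  obtain A B \<alpha> where k: "k = (\<lambda>x. A * m x + B * m (- x))" and f: "f = (\<lambda>x. \<alpha> * k x)"
    using pair unfolding exponential_pair_def by blast
  have r: "continuous_map T euclidean (\<lambda>x. m (- x))"
    using continuous_map_reflect[OF T] m by blast
  show "continuous_map T euclidean k"
    unfolding k by (rule continuous_map_lincomb[OF m r])
  then show "continuous_map T euclidean f"
    using continuous_map_lincomb[of T k k \<alpha> 0] by (simp add: f)
qed

lemma exponential_continuous_if_at_zero:
  assumes T: "topological_ab_group T" and m: "exponential m"
    and at0: "\<And>\<delta>. 0 < \<delta> \<Longrightarrow> \<delta> \<le> 1 \<Longrightarrow> \<exists>V. openin T V \<and> 0 \<in> V \<and> (\<forall>v\<in>V. cmod (m v - 1) < \<delta>)"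
  shows "continuous_map T euclidean m"
  unfolding continuous_map_eq_topcontinuous_at topcontinuous_at_def
proof (intro ballI conjI allI impI)
  fix x W assume "openin euclidean W \<and> m x \<in> W"
  then obtain e where e: "e > 0" "ball (m x) e \<subseteq> W"
    by (auto simp: open_contains_ball)
  have mx: "cmod (m x) > 0" using exponential_nonzero[OF m] by simp
  define \<delta> where "\<delta> = min 1 (e / cmod (m x))"
  obtain V where V: "openin T V" "0 \<in> V" "\<And>v. v \<in> V \<Longrightarrow> cmod (m v - 1) < \<delta>"
    using at0[of \<delta>] e mx by (auto simp: \<delta>_def)
  have "openin T {y \<in> topspace T. y + (- x) \<in> V}"
    by (rule openin_continuous_map_preimage[OF topological_ab_groupD(3)[OF T] V(1)])
  moreover have "m y \<in> W" if "y + (- x) \<in> V" for y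
  proof -
    have "m y - m x = m x * (m (y + (- x)) - 1)"
      using exponential_add[OF m, of x "y + (- x)"] by (simp add: algebra_simps)
    then have "cmod (m y - m x) = cmod (m x) * cmod (m (y + (- x)) - 1)"
      by (simp add: norm_mult)
    also have "\<dots> < cmod (m x) * \<delta>" using V(3)[OF that] mx by simp
    also have "\<dots> \<le> cmod (m x) * (e / cmod (m x))" using mx by (intro mult_left_mono) (auto simp: \<delta>_def)
    finally have "cmod (m y - m x) < e" using mx by simp
    then show ?thesis using e(2) by (auto simp: dist_norm norm_minus_commute)
  qed
  ultimately show "\<exists>U. openin T U \<and> x \<in> U \<and> (\<forall>y\<in>U. m y \<in> W)"
    using V(2) by (intro exI[of _ "{y \<in> topspace T. y + (- x) \<in> V}"])
      (auto simp: topological_ab_groupD(1)[OF T])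
qed (auto simp: topological_ab_groupD(1)[OF T])

section \<open>Translations and Haar measure\<close>

locale haar_group =
  fixes T :: "'a::ab_group_add topology" and \<eta> :: "'a measure"
  assumes group: "topological_ab_group T" and haar: "haar_measure T \<eta>"
begin

lemma
  shows space_haar: "space \<eta> = UNIV"
    and sets_haar: "sets \<eta> = sigma_sets UNIV {U. openin T U}"
    and emeasure_translate: "A \<in> sets \<eta> \<Longrightarrow> emeasure \<eta> ((\<lambda>x. a + x) ` A) = emeasure \<eta> A"
    and finite_on_compact: "closed_compact T K \<Longrightarrow> emeasure \<eta> K < \<infinity>"
    and outer_regular: "A \<in> sets \<eta> \<Longrightarrow>
      emeasure \<eta> A = (INF U\<in>{U. openin T U \<and> A \<subseteq> U}. emeasure \<eta> U)"
    and inner_regular: "openin T U \<Longrightarrow>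
      emeasure \<eta> U = (SUP K\<in>{K. closed_compact T K \<and> K \<subseteq> U}. emeasure \<eta> K)"
  using haar unfolding haar_measure_def by auto

lemma open_sets: "openin T U \<Longrightarrow> U \<in> sets \<eta>"
  by (simp add: sets_haar sigma_sets.Basic)

lemma closed_compact_sets: "closed_compact T K \<Longrightarrow> K \<in> sets \<eta>"
proof -
  assume "closed_compact T K"
  then have "openin T (UNIV - K)"
    unfolding closed_compact_def using topological_ab_groupD(1)[OF group] by (metis closedin_def)
  then have "space \<eta> - (UNIV - K) \<in> sets \<eta>" by (intro sets.compl_sets open_sets)
  then show ?thesis by (simp add: space_haar Diff_Diff_Int)
qed

lemma translate_vimage:
  fixes A :: "'a set"
  shows "(\<lambda>x. - a + x) ` A = (\<lambda>x. x + a) -` A"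
proof -
  have "x \<in> (\<lambda>x. - a + x) ` A" if "x + a \<in> A" for x
    by (rule image_eqI[OF _ that]) (simp only: add.commute[of x a] minus_add_cancel)
  then show ?thesis by auto
qed

lemma translate_measurable: "(\<lambda>x. x + a) \<in> measurable \<eta> \<eta>"
proof (rule measurable_sigma_sets[OF sets_haar])
  fix U assume "U \<in> {U. openin T U}"
  then have "openin T {x \<in> topspace T. x + a \<in> U}"
    by (intro openin_continuous_map_preimage[OF topological_ab_groupD(3)[OF group]]) auto
  then show "(\<lambda>x. x + a) -` U \<inter> space \<eta> \<in> sets \<eta>"
    using open_sets by (simp add: topological_ab_groupD(1)[OF group] space_haar vimage_def)
qed auto

lemma translate_vimage_sets: "A \<in> sets \<eta> \<Longrightarrow> (\<lambda>x. x + a) -` A \<in> sets \<eta>"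
  using measurable_sets[OF translate_measurable, of A a] by (simp add: space_haar)

lemma emeasure_translate_vimage:
  "A \<in> sets \<eta> \<Longrightarrow> emeasure \<eta> ((\<lambda>x. x + a) -` A) = emeasure \<eta> A"
  using emeasure_translate[of A "- a"] unfolding translate_vimage .

lemma translate_vimage_null: "N \<in> null_sets \<eta> \<Longrightarrow> (\<lambda>x. x + a) -` N \<in> null_sets \<eta>"
  by (auto simp: null_sets_def translate_vimage_sets emeasure_translate_vimage)

lemma translate_AE: "(AE x in \<eta>. P x) \<Longrightarrow> (AE x in \<eta>. P (x + a))"
proof -
  assume "AE x in \<eta>. P x"
  then obtain N where N: "\<And>x. x \<in> space \<eta> - N \<Longrightarrow> P x" "N \<in> null_sets \<eta>"
    by (rule AE_E3) blast
  show "AE x in \<eta>. P (x + a)"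
    by (rule AE_I'[OF translate_vimage_null[OF N(2), of a]]) (use N(1) space_haar in auto)
qed

lemma translate_measurable_completion: "(\<lambda>x. x + a) \<in> measurable (completion \<eta>) (completion \<eta>)"
proof (rule measurableI)
  fix A assume "A \<in> sets (completion \<eta>)"
  then obtain S N N' where A: "A = S \<union> N" "N \<subseteq> N'" "N' \<in> null_sets \<eta>" "S \<in> sets \<eta>"
    by (rule sets_completionE)
  have "(\<lambda>x. x + a) -` A \<in> sets (completion \<eta>)"
    by (rule sets_completionI[of _ "(\<lambda>x. x + a) -` S" "(\<lambda>x. x + a) -` N" "(\<lambda>x. x + a) -` N'"])
      (use A in \<open>auto intro: translate_vimage_null translate_vimage_sets\<close>)
  then show "(\<lambda>x. x + a) -` A \<inter> space (completion \<eta>) \<in> sets (completion \<eta>)"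
    by (simp add: space_haar)
qed (simp add: space_haar)

lemma closed_compact_translate:
  assumes "closed_compact T K" shows "closed_compact T ((\<lambda>x. x + a) ` K)"
proof -
  have "compactin T ((\<lambda>x. x + a) ` K)"
    using assms topological_ab_groupD(3)[OF group]
    by (auto simp: closed_compact_def intro: image_compactin)
  moreover have "closedin T {x \<in> topspace T. x + (- a) \<in> K}"
    using assms by (intro closedin_continuous_map_preimage[OF topological_ab_groupD(3)[OF group]])
      (simp add: closed_compact_def)
  moreover have "{x \<in> topspace T. x + (- a) \<in> K} = (\<lambda>x. x + a) ` K"
    using topological_ab_groupD(1)[OF group] by (force simp: image_iff algebra_simps)
  ultimately show ?thesis by (simp add: closed_compact_def)
qed

lemma haar_measurable_translate:
  assumes "haar_measurable T \<eta> g" shows "haar_measurable T \<eta> (\<lambda>x. g (x + a))"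
  unfolding haar_measurable_def
proof (intro allI impI)
  fix K assume K: "closed_compact T K"
  let ?K = "(\<lambda>x. x + a) ` K"
  have "g \<in> borel_measurable (restrict_space (completion \<eta>) ?K)"
    using assms closed_compact_translate[OF K] by (simp add: haar_measurable_def)
  moreover have "(\<lambda>x. x + a) \<in> measurable (restrict_space (completion \<eta>) K)
      (restrict_space (completion \<eta>) ?K)"
    by (intro measurable_restrict_space3 translate_measurable_completion) auto
  ultimately show "(\<lambda>x. g (x + a)) \<in> borel_measurable (restrict_space (completion \<eta>) K)"
    by simp
qed

lemma haar_measurable_lincomb:
  "haar_measurable T \<eta> g \<Longrightarrow> haar_measurable T \<eta> h \<Longrightarrow>
    haar_measurable T \<eta> (\<lambda>x. c * g x + d * h x)"
  unfolding haar_measurable_def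
  by (auto intro!: borel_measurable_add borel_measurable_times borel_measurable_const)

lemma ess_bounded_translate:
  assumes "ess_bounded T \<eta> g" shows "ess_bounded T \<eta> (\<lambda>x. g (x + a))"
proof -
  obtain C where C: "\<And>K. closed_compact T K \<Longrightarrow> (AE x in \<eta>. x \<in> K \<longrightarrow> cmod (g x) \<le> C)"
    using assms by (auto simp: ess_bounded_def)
  have "AE x in \<eta>. x \<in> K \<longrightarrow> cmod (g (x + a)) \<le> C" if "closed_compact T K" for K
    using translate_AE[OF C[OF closed_compact_translate[OF that, of a]], of a]
    by (rule AE_mp) auto
  then show ?thesis by (auto simp: ess_bounded_def)
qed

lemma ess_bounded_lincomb:
  assumes "ess_bounded T \<eta> g" "ess_bounded T \<eta> h"
  shows "ess_bounded T \<eta> (\<lambda>x. c * g x + d * h x)"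
proof -
  obtain C D where C: "\<And>K. closed_compact T K \<Longrightarrow> (AE x in \<eta>. x \<in> K \<longrightarrow> cmod (g x) \<le> C)"
    and D: "\<And>K. closed_compact T K \<Longrightarrow> (AE x in \<eta>. x \<in> K \<longrightarrow> cmod (h x) \<le> D)"
    using assms by (auto simp: ess_bounded_def)
  have *: "cmod (c * u + d * v) \<le> cmod c * C + cmod d * D" if "cmod u \<le> C" "cmod v \<le> D" for u v
  proof -
    have "cmod (c * u + d * v) \<le> cmod c * cmod u + cmod d * cmod v"
      using norm_triangle_ineq[of "c * u" "d * v"] by (simp add: norm_mult)
    also have "\<dots> \<le> cmod c * C + cmod d * D"
      using that by (intro add_mono mult_left_mono) auto
    finally show ?thesis .
  qed
  have "AE x in \<eta>. x \<in> K \<longrightarrow> cmod (c * g x + d * h x) \<le> cmod c * C + cmod d * D"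
    if "closed_compact T K" for K
    using C[OF that] D[OF that] by eventually_elim (use * in blast)
  then show ?thesis unfolding ess_bounded_def by blast
qed


section \<open>Measurable exponentials\<close>

lemma positive_closed_compact: obtains K where "closed_compact T K" "0 < emeasure \<eta> K"
proof -
  have "openin T UNIV" using topological_ab_groupD(1)[OF group] openin_topspace[of T] by simp
  then have "emeasure \<eta> UNIV = (SUP K\<in>{K. closed_compact T K \<and> K \<subseteq> UNIV}. emeasure \<eta> K)"
    by (rule inner_regular)
  moreover have "0 < emeasure \<eta> UNIV"
    using haar by (simp add: haar_measure_def zero_less_iff_neq_zero)
  ultimately show thesis using that by (auto simp: less_SUP_iff)
qed

text \<open>
  The theorem of Steinhaus.  Choose \<open>U \<supseteq> E\<close> open and \<open>K \<subseteq> U\<close> compact so that \<open>U\<close> is hardly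
  larger than \<open>E\<close>, and \<open>K\<close> hardly smaller than \<open>U\<close>, in measure.  A small translation keeps \<open>K\<close> inside \<open>U\<close>, so
  \<open>E \<inter> K\<close> and its translate both lie in \<open>U\<close>, which is too small to hold them disjointly.  Working
  with \<open>E \<inter> K\<close> means that inner regularity is applied to the open set \<open>U\<close>, not to the Borel set \<open>E\<close>.
\<close>

lemma Steinhaus:
  assumes E: "E \<in> sets \<eta>" "0 < emeasure \<eta> E" "emeasure \<eta> E < \<infinity>"
  obtains V where "openin T V" "0 \<in> V" "\<And>v. v \<in> V \<Longrightarrow> \<exists>x\<in>E. x + v \<in> E"
proof -
  define e where "e = measure \<eta> E"
  have Ee: "emeasure \<eta> E = ennreal e"
    unfolding e_def using E by (intro emeasure_eq_ennreal_measure) auto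
  have e0: "e > 0" using E Ee by simp
  \<comment> \<open>These margins leave \<open>E \<inter> K\<close> more than two thirds of the measure of \<open>E\<close>, and \<open>U\<close> less than
    twice that.\<close>
  have "(INF U\<in>{U. openin T U \<and> E \<subseteq> U}. emeasure \<eta> U) < ennreal (4 / 3 * e)"
    unfolding outer_regular[OF E(1), symmetric] Ee using e0 by (simp add: ennreal_less_iff)
  then obtain U where U: "openin T U" "E \<subseteq> U" "emeasure \<eta> U < ennreal (4 / 3 * e)"
    by (auto simp: INF_less_iff)
  have Ufin: "U \<in> fmeasurable \<eta>"
    using U(3) open_sets[OF U(1)] by (intro fmeasurableI) (auto intro: less_trans)
  then have Uu: "emeasure \<eta> U = ennreal (measure \<eta> U)"
    by (rule emeasure_eq_measure2)
  have u: "measure \<eta> U < 4 / 3 * e" using U(3) e0 unfolding Uu by (simp add: ennreal_less_iff)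
  have Efin: "E \<in> fmeasurable \<eta>" using E by (intro fmeasurableI) auto
  have eu: "e \<le> measure \<eta> U" unfolding e_def by (rule measure_mono_fmeasurable[OF U(2) E(1) Ufin])
  have "ennreal (measure \<eta> U - e / 3) < emeasure \<eta> U"
    unfolding Uu using eu e0 by (simp add: ennreal_less_iff)
  then have "ennreal (measure \<eta> U - e / 3) <
      (SUP K\<in>{K. closed_compact T K \<and> K \<subseteq> U}. emeasure \<eta> K)"
    using inner_regular[OF U(1)] by simp
  then obtain K where K: "closed_compact T K" "K \<subseteq> U"
    "ennreal (measure \<eta> U - e / 3) < emeasure \<eta> K"
    by (auto simp: less_SUP_iff)
  have Kfin: "K \<in> fmeasurable \<eta>"
    using finite_on_compact[OF K(1)] closed_compact_sets[OF K(1)] by (intro fmeasurableI) auto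
  have k: "measure \<eta> U - e / 3 < measure \<eta> K"
    using K(3) eu e0 unfolding emeasure_eq_measure2[OF Kfin] by (simp add: ennreal_less_iff)
  have EK: "measure \<eta> (E \<inter> K) > 2 / 3 * e"
  proof -
    have "measure \<eta> (E \<union> K) \<le> measure \<eta> U"
      using U(2) K(2) E(1) closed_compact_sets[OF K(1)] by (intro measure_mono_fmeasurable[OF _ _ Ufin]) auto
    then show ?thesis using measure_Un3[OF Efin Kfin] k unfolding e_def by simp
  qed
  have op: "openin (prod_topology T T) {p \<in> topspace (prod_topology T T). (case p of (x, y) \<Rightarrow> x + y) \<in> U}"
    by (rule openin_continuous_map_preimage[OF topological_ab_groupD(2)[OF group] U(1)])
  have comp: "compactin T {0}" "compactin T K"
    using K(1) topological_ab_groupD(1)[OF group] by (auto simp: closed_compact_def)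
  have sub: "{0} \<times> K \<subseteq> {p \<in> topspace (prod_topology T T). (case p of (x, y) \<Rightarrow> x + y) \<in> U}"
    using K(2) topological_ab_groupD(1)[OF group] by auto
  obtain V W where V: "openin T V" "{0} \<subseteq> V" "K \<subseteq> W"
    "V \<times> W \<subseteq> {p \<in> topspace (prod_topology T T). (case p of (x, y) \<Rightarrow> x + y) \<in> U}"
    by (rule Wallace_theorem_prod_topology[OF comp op sub])
  have "\<exists>x\<in>E. x + v \<in> E" if v: "v \<in> V" for v
  proof (rule ccontr)
    assume neg: "\<not> (\<exists>x\<in>E. x + v \<in> E)"
    define F where "F = E \<inter> K"
    define F' where "F' = (\<lambda>x. v + x) ` F"
    have F: "F \<in> sets \<eta>" using E(1) closed_compact_sets[OF K(1)] by (auto simp: F_def)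
    have F': "F' \<in> sets \<eta>"
      using translate_vimage_sets[OF F, of "- v"] translate_vimage[of "- v" F] by (simp add: F'_def)
    have "v + x \<in> U" if "x \<in> K" for x
    proof -
      have "(v, x) \<in> V \<times> W" using V(3) v that by blast
      then show ?thesis using V(4) by auto
    qed
    then have sub: "F \<subseteq> U" "F' \<subseteq> U" using U(2) by (auto simp: F_def F'_def)
    have fin: "F \<in> fmeasurable \<eta>" "F' \<in> fmeasurable \<eta>"
      by (rule fmeasurableI2[OF Ufin sub(1) F], rule fmeasurableI2[OF Ufin sub(2) F'])
    have "F \<inter> F' = {}" using neg by (auto simp: F_def F'_def add.commute)
    moreover have "measure \<eta> F' = measure \<eta> F"
      using emeasure_translate[OF F, of v] by (simp add: measure_def F'_def)
    ultimately have "measure \<eta> (F \<union> F') = 2 * measure \<eta> F"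
      using measure_Un3[OF fin] by simp
    moreover have "measure \<eta> (F \<union> F') \<le> measure \<eta> U"
      using sub F F' by (intro measure_mono_fmeasurable[OF _ _ Ufin]) auto
    ultimately show False using EK u by (simp add: F_def)
  qed
  then show thesis using that V by auto
qed

text \<open>
  On a set \<open>E\<close> where \<open>m\<close> varies by less than a small fraction of its modulus, \<open>m\<close> is close to
  \<open>1\<close> at all differences of elements of \<open>E\<close>.  Countably many discs around points of a dense set, with
  radius proportional to the modulus of the centre, cover all nonzero complex numbers; so for one of
  these discs the preimage has positive measure, and its set of differences is a neighbourhood of
  \<open>0\<close> by the theorem of Steinhaus.
\<close>

lemma measurable_exponential_continuous:
  assumes m: "exponential m" and meas: "haar_measurable T \<eta> m"
  shows "continuous_map T euclidean m"
proof (rule exponential_continuous_if_at_zero[OF group m])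
  fix \<delta> :: real assume \<delta>: "0 < \<delta>" "\<delta> \<le> 1"
  obtain K where K: "closed_compact T K" "0 < emeasure \<eta> K" by (rule positive_closed_compact)
  obtain D :: "complex set" where D: "countable D"
    "\<And>X. open X \<Longrightarrow> X \<noteq> {} \<Longrightarrow> \<exists>d\<in>D. d \<in> X"
    by (rule countable_dense_setE) blast
  define E where "E c = m -` ball c (\<delta> / 3 * cmod c) \<inter> K" for c
  have Kc: "K \<in> sets (completion \<eta>)" using closed_compact_sets[OF K(1)] by simp
  have Ec: "E c \<in> sets (completion \<eta>)" for c
  proof -
    have "m \<in> borel_measurable (restrict_space (completion \<eta>) K)"
      using meas K(1) by (simp add: haar_measurable_def)
    from measurable_sets[OF this, of "ball c (\<delta> / 3 * cmod c)"]
    have "E c \<in> sets (restrict_space (completion \<eta>) K)"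
      by (simp add: E_def space_restrict_space space_haar)
    then show ?thesis using Kc by (simp add: sets_restrict_space_iff space_haar)
  qed
  have cover: "K \<subseteq> (\<Union>c\<in>D. E c)"
  proof
    fix x assume x: "x \<in> K"
    have "open {c. dist c (m x) < \<delta> / 3 * cmod c}"
      by (intro open_Collect_less continuous_intros)
    moreover have "m x \<in> {c. dist c (m x) < \<delta> / 3 * cmod c}"
      using exponential_nonzero[OF m] \<delta> by simp
    ultimately obtain c where "c \<in> D" "dist c (m x) < \<delta> / 3 * cmod c"
      using D(2) by blast
    then show "x \<in> (\<Union>c\<in>D. E c)" using x by (auto simp: E_def)
  qed
  have "\<exists>c\<in>D. emeasure (completion \<eta>) (E c) \<noteq> 0"
  proof (rule ccontr)
    assume "\<not> ?thesis"
    then have "(\<Union>c\<in>D. E c) \<in> null_sets (completion \<eta>)"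
      using Ec D(1) by (intro null_sets_UN') (auto simp: null_sets_def simp del: emeasure_completion)
    then have "emeasure (completion \<eta>) K = 0"
      using null_sets_subset[OF _ Kc cover] by (auto simp del: emeasure_completion)
    then show False using K closed_compact_sets[OF K(1)] by simp
  qed
  then obtain c where c: "emeasure (completion \<eta>) (E c) \<noteq> 0" by blast
  define E' where "E' = main_part \<eta> (E c)"
  have E'sub: "E' \<subseteq> E c" using main_part_null_part_Un[OF Ec[of c]] by (auto simp: E'_def)
  have E'sets: "E' \<in> sets \<eta>" unfolding E'_def by (rule main_part_sets[OF Ec])
  have "0 < emeasure \<eta> E'" using c Ec[of c] by (simp add: E'_def zero_less_iff_neq_zero)
  moreover have "emeasure \<eta> E' < \<infinity>"
    using emeasure_mono[of E' K \<eta>] E'sub closed_compact_sets[OF K(1)] finite_on_compact[OF K(1)]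
    by (auto simp: E_def intro: le_less_trans)
  ultimately obtain V where V: "openin T V" "0 \<in> V" "\<And>v. v \<in> V \<Longrightarrow> \<exists>x\<in>E'. x + v \<in> E'"
    using Steinhaus[OF E'sets] by blast
  have "cmod (m v - 1) < \<delta>" if "v \<in> V" for v
  proof -
    obtain x where "x \<in> E c" "x + v \<in> E c" using V(3)[OF \<open>v \<in> V\<close>] E'sub by blast
    then have 1: "cmod (c - m x) < \<delta> / 3 * cmod c" and 2: "cmod (c - m (x + v)) < \<delta> / 3 * cmod c"
      by (auto simp: E_def dist_norm)
    have "m (x + v) - m x = m x * (m v - 1)" by (simp add: exponential_add[OF m] algebra_simps)
    then have "cmod (m x) * cmod (m v - 1) = cmod (m (x + v) - m x)" by (simp add: norm_mult)
    also have "\<dots> \<le> cmod (c - m x) + cmod (c - m (x + v))"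
      using norm_triangle_ineq4[of "c - m x" "c - m (x + v)"] by simp
    also have "\<dots> < \<delta> * (2 / 3 * cmod c)" using 1 2 by simp
    also have "\<dots> \<le> \<delta> * cmod (m x)"
    proof (rule mult_left_mono)
      have "cmod c \<le> cmod (c - m x) + cmod (m x)"
        using norm_triangle_ineq[of "c - m x" "m x"] by simp
      moreover have "\<delta> / 3 * cmod c \<le> 1 / 3 * cmod c" using \<delta> by (intro mult_right_mono) auto
      ultimately show "2 / 3 * cmod c \<le> cmod (m x)" using 1 by linarith
    qed (use \<delta> in simp)
    finally show ?thesis using exponential_nonzero[OF m, of x] by (simp add: mult.commute)
  qed
  then show "\<exists>V. openin T V \<and> 0 \<in> V \<and> (\<forall>v\<in>V. cmod (m v - 1) < \<delta>)"
    using V by blast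
qed

text \<open>
  If \<open>cmod (m a) > 1\<close>, the bound for \<open>m\<close> on the translates of a compact set \<open>K\<close> by \<open>n\<close> times
  \<open>a\<close> gives \<open>cmod (m x) \<le> C / cmod (m a) ^ n\<close> for almost every \<open>x\<close> in \<open>K\<close>, for all
  \<open>n\<close>, whereas \<open>m\<close> has no zeros.
\<close>

lemma ess_bounded_exponential_le_1:
  assumes m: "exponential m" and bd: "ess_bounded T \<eta> m"
  shows "cmod (m a) \<le> 1"
proof (rule ccontr)
  assume "\<not> cmod (m a) \<le> 1"
  then have a: "cmod (m a) > 1" by simp
  obtain C where C: "\<And>K. closed_compact T K \<Longrightarrow> (AE x in \<eta>. x \<in> K \<longrightarrow> cmod (m x) \<le> C)"
    using bd by (auto simp: ess_bounded_def)
  obtain K where K: "closed_compact T K" "0 < emeasure \<eta> K" by (rule positive_closed_compact)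
  \<comment> \<open>\<open>b n\<close> is \<open>n\<close> times \<open>a\<close>.\<close>
  define b where "b n = ((+) a ^^ n) 0" for n
  have mb: "m (x + b n) = m x * m a ^ n" for x n
    using exponential_of_nat[OF m, of n a 0] exponential_add[OF m, of x "b n"] exponential_zero[OF m]
    by (simp add: b_def)
  have "AE x in \<eta>. x \<in> K \<longrightarrow> cmod (m (x + b n)) \<le> C" for n
    using translate_AE[OF C[OF closed_compact_translate[OF K(1), of "b n"]], of "b n"]
    by (rule AE_mp) auto
  then have "AE x in \<eta>. \<forall>n. x \<in> K \<longrightarrow> cmod (m (x + b n)) \<le> C"
    unfolding AE_all_countable by blast
  then have "AE x in \<eta>. x \<notin> K"
  proof (rule AE_mp, intro AE_I2 impI notI)
    fix x assume "\<forall>n. x \<in> K \<longrightarrow> cmod (m (x + b n)) \<le> C" "x \<in> K"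
    then have *: "cmod (m x) * cmod (m a) ^ n \<le> C" for n
      by (simp add: mb norm_mult norm_power)
    have mx: "cmod (m x) > 0" using exponential_nonzero[OF m] by simp
    obtain n where "C / cmod (m x) < cmod (m a) ^ n" using real_arch_pow[OF a] by blast
    then show False using *[of n] mx by (simp add: field_simps)
  qed
  then have "emeasure \<eta> K = 0"
    using AE_iff_null_sets[of K \<eta>] closed_compact_sets[OF K(1)] by (auto simp: null_sets_def)
  then show False using K(2) by simp
qed

lemma ess_bounded_exponential_unimodular:
  assumes m: "exponential m" and bd: "ess_bounded T \<eta> m"
  shows "cmod (m a) = 1"
proof (rule antisym)
  show "cmod (m a) \<le> 1" by (rule ess_bounded_exponential_le_1[OF assms])
  have "cmod (m (- a)) * cmod (m a) = 1"
    using exponential_minus_mult[OF m, of a] by (metis norm_mult norm_one)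
  moreover have "cmod (m (- a)) * cmod (m a) \<le> 1 * cmod (m a)"
    by (intro mult_right_mono ess_bounded_exponential_le_1[OF assms]) simp
  ultimately show "1 \<le> cmod (m a)" by simp
qed

lemma measurable_pair_continuous:
  assumes pair: "exponential_pair m f k" and "k \<noteq> (\<lambda>x. 0)"
    and "haar_measurable T \<eta> f \<or> haar_measurable T \<eta> k"
  shows "continuous_map T euclidean m"
proof -
  have m: "exponential m" using pair by (simp add: exponential_pair_def)
  have "haar_measurable T \<eta> m \<or> haar_measurable T \<eta> (reflect m)"
    by (rule exponential_from_translates[where R = "haar_measurable T \<eta>", OF _ _ assms])
      (auto intro: haar_measurable_translate haar_measurable_lincomb)
  then show ?thesis
    using measurable_exponential_continuous[OF m] continuous_map_reflect[OF group, of _ m]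
      measurable_exponential_continuous[OF exponential_reflect[OF m]]
    by (auto simp: reflect_def)
qed

lemma ess_bounded_pair_character:
  assumes pair: "exponential_pair m f k" and nz: "k \<noteq> (\<lambda>x. 0)"
    and bd: "(ess_bounded T \<eta> f \<and> haar_measurable T \<eta> f) \<or>
        (ess_bounded T \<eta> k \<and> haar_measurable T \<eta> k)"
  shows "character T m"
proof -
  have m: "exponential m" using pair by (simp add: exponential_pair_def)
  have cont: "continuous_map T euclidean m"
    by (rule measurable_pair_continuous[OF pair nz]) (use bd in blast)
  have "ess_bounded T \<eta> m \<or> ess_bounded T \<eta> (reflect m)"
    by (rule exponential_from_translates[where R = "ess_bounded T \<eta>", OF _ _ pair nz])
      (use bd in \<open>auto intro: ess_bounded_translate ess_bounded_lincomb\<close>)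
  then have "cmod (m x) = 1" for x
    using ess_bounded_exponential_unimodular[OF m, of x]
      ess_bounded_exponential_unimodular[OF exponential_reflect[OF m], of "- x"]
    by (auto simp: reflect_def)
  then show ?thesis using cont exponential_add[OF m] by (simp add: character_def)
qed

end

lemma continuous_pair_exponential_continuous:
  assumes T: "topological_ab_group T" and "exponential_pair m f k" and "k \<noteq> (\<lambda>x. 0)"
    and "continuous_map T euclidean f \<or> continuous_map T euclidean k"
  shows "continuous_map T euclidean m"
proof -
  have "continuous_map T euclidean m \<or> continuous_map T euclidean (reflect m)"
    by (rule exponential_from_translates[where R = "continuous_map T euclidean", OF _ _ assms(2-)])
      (auto intro: continuous_map_translate[OF T] continuous_map_lincomb)
  then show ?thesis using continuous_map_reflect[OF T, of _ m] by (auto simp: reflect_def)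
qed

lemma solution_pair:
  assumes "solves_equation \<Sigma> \<mu> f k" "f \<noteq> (\<lambda>x. 0)" "k \<noteq> (\<lambda>x. 0)"
  obtains m where "exponential_pair m f k"
  using solution_forms[OF assms]
  by (elim disjE exE) (erule that[OF noneven_form_pair] that[OF even_form_pair])+


section \<open>Description and regularity of the solutions\<close>

theorem theorem6:
  fixes \<Sigma> :: "'a::ab_group_add set set" and \<mu> :: "'a set \<Rightarrow> complex"
  assumes "complex_measure \<Sigma> \<mu>"
  shows
    "\<comment> \<open>description of the solutions\<close>
     (\<forall>f k. f \<noteq> (\<lambda>x. 0) \<longrightarrow> k \<noteq> (\<lambda>x. 0) \<longrightarrow> solves_equation \<Sigma> \<mu> f k \<longrightarrow>
        (\<exists>m \<alpha>. noneven_form \<Sigma> \<mu> m \<alpha> f k) \<or> (\<exists>m\<^sub>0 \<alpha>. even_form \<Sigma> \<mu> m\<^sub>0 \<alpha> f k)) \<and>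
     \<comment> \<open>converse\<close>
     (\<forall>m \<alpha> f k. noneven_form \<Sigma> \<mu> m \<alpha> f k \<longrightarrow> solves_equation \<Sigma> \<mu> f k) \<and>
     (\<forall>m\<^sub>0 \<alpha> f k. even_form \<Sigma> \<mu> m\<^sub>0 \<alpha> f k \<longrightarrow> solves_equation \<Sigma> \<mu> f k) \<and>
     \<comment> \<open>continuous solutions\<close>
     (\<forall>T f k. topological_ab_group T \<longrightarrow>
        f \<noteq> (\<lambda>x. 0) \<longrightarrow> k \<noteq> (\<lambda>x. 0) \<longrightarrow> solves_equation \<Sigma> \<mu> f k \<longrightarrow>
        continuous_map T euclidean f \<or> continuous_map T euclidean k \<longrightarrow>
        (\<forall>m \<alpha>. noneven_form \<Sigma> \<mu> m \<alpha> f k \<longrightarrow> continuous_map T euclidean m) \<and>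
        (\<forall>m\<^sub>0 \<alpha>. even_form \<Sigma> \<mu> m\<^sub>0 \<alpha> f k \<longrightarrow> continuous_map T euclidean m\<^sub>0)) \<and>
     \<comment> \<open>measurable solutions\<close>
     (\<forall>T \<eta> f k. topological_ab_group T \<longrightarrow> locally_compact_space T \<longrightarrow> haar_measure T \<eta> \<longrightarrow>
        f \<noteq> (\<lambda>x. 0) \<longrightarrow> k \<noteq> (\<lambda>x. 0) \<longrightarrow> solves_equation \<Sigma> \<mu> f k \<longrightarrow>
        haar_measurable T \<eta> f \<or> haar_measurable T \<eta> k \<longrightarrow>
        continuous_map T euclidean f \<and> continuous_map T euclidean k \<and>
        (\<forall>m \<alpha>. noneven_form \<Sigma> \<mu> m \<alpha> f k \<longrightarrow> continuous_map T euclidean m) \<and>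
        (\<forall>m\<^sub>0 \<alpha>. even_form \<Sigma> \<mu> m\<^sub>0 \<alpha> f k \<longrightarrow> continuous_map T euclidean m\<^sub>0)) \<and>
     \<comment> \<open>essentially bounded measurable solutions\<close>
     (\<forall>T \<eta> f k. topological_ab_group T \<longrightarrow> locally_compact_space T \<longrightarrow> haar_measure T \<eta> \<longrightarrow>
        f \<noteq> (\<lambda>x. 0) \<longrightarrow> k \<noteq> (\<lambda>x. 0) \<longrightarrow> solves_equation \<Sigma> \<mu> f k \<longrightarrow>
        (ess_bounded T \<eta> f \<and> haar_measurable T \<eta> f) \<or>
        (ess_bounded T \<eta> k \<and> haar_measurable T \<eta> k) \<longrightarrow>
        continuous_map T euclidean f \<and> continuous_map T euclidean k \<and>
        (\<forall>m \<alpha>. noneven_form \<Sigma> \<mu> m \<alpha> f k \<longrightarrow> character T m) \<and>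
        (\<forall>m\<^sub>0 \<alpha>. even_form \<Sigma> \<mu> m\<^sub>0 \<alpha> f k \<longrightarrow> character T m\<^sub>0))"
proof -
  have cont: "continuous_map T euclidean f \<and> continuous_map T euclidean k \<and>
      (\<forall>m \<alpha>. noneven_form \<Sigma> \<mu> m \<alpha> f k \<longrightarrow> continuous_map T euclidean m) \<and>
      (\<forall>m\<^sub>0 \<alpha>. even_form \<Sigma> \<mu> m\<^sub>0 \<alpha> f k \<longrightarrow> continuous_map T euclidean m\<^sub>0)"
    if T: "topological_ab_group T" "haar_measure T \<eta>"
      and nz: "f \<noteq> (\<lambda>x. 0)" "k \<noteq> (\<lambda>x. 0)" and sol: "solves_equation \<Sigma> \<mu> f k"
      and meas: "haar_measurable T \<eta> f \<or> haar_measurable T \<eta> k"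
    for T :: "'a topology" and \<eta> f k
  proof -
    interpret haar_group T \<eta> by unfold_locales (fact T)+
    obtain m where pair: "exponential_pair m f k" by (rule solution_pair[OF sol nz])
    have c: "continuous_map T euclidean n" if "exponential_pair n f k" for n
      by (rule measurable_pair_continuous[OF that nz(2) meas])
    show ?thesis
      using exponential_pair_continuous[OF T(1) pair c[OF pair]]
        c[OF noneven_form_pair] c[OF even_form_pair] by simp
  qed
  have char: "character T m"
    if "topological_ab_group T" "haar_measure T \<eta>" "k \<noteq> (\<lambda>x. 0)"
      "(ess_bounded T \<eta> f \<and> haar_measurable T \<eta> f) \<or>
        (ess_bounded T \<eta> k \<and> haar_measurable T \<eta> k)"
      "noneven_form \<Sigma> \<mu> m \<alpha> f k \<or> even_form \<Sigma> \<mu> m \<alpha> f k"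
    for T :: "'a topology" and \<eta> f k m \<alpha>
  proof -
    interpret haar_group T \<eta> by unfold_locales (fact that)+
    show ?thesis
      using that(5) ess_bounded_pair_character[OF noneven_form_pair that(3,4)]
        ess_bounded_pair_character[OF even_form_pair that(3,4)] by metis
  qed
  show ?thesis
  proof (intro conjI allI impI, goal_cases)
    case (1 f k)
    then show ?case by (intro solution_forms)
  next
    case (2 m \<alpha> f k)
    then show ?case by (rule noneven_form_solves)
  next
    case (3 m \<alpha> f k)
    then show ?case by (rule even_form_solves)
  next
    case (4 T f k m \<alpha>)
    show ?case
      by (rule continuous_pair_exponential_continuous[OF 4(1) noneven_form_pair[OF 4(6)] 4(3,5)])
  next
    case (5 T f k m \<alpha>)
    show ?case
      by (rule continuous_pair_exponential_continuous[OF 5(1) even_form_pair[OF 5(6)] 5(3,5)])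
  next
    case (6 T \<eta> f k)
    show ?case using cont[OF 6(1,3-7)] by blast
  next
    case (7 T \<eta> f k)
    show ?case using cont[OF 7(1,3-7)] by blast
  next
    case (8 T \<eta> f k m \<alpha>)
    show ?case using cont[OF 8(1,3-7)] 8(8) by blast
  next
    case (9 T \<eta> f k m \<alpha>)
    show ?case using cont[OF 9(1,3-7)] 9(8) by blast
  next
    case (10 T \<eta> f k)
    then show ?case using cont[OF 10(1,3-6)] by blast
  next
    case (11 T \<eta> f k)
    then show ?case using cont[OF 11(1,3-6)] by blast
  next
    case (12 T \<eta> f k m \<alpha>)
    show ?case by (rule char[OF 12(1,3,5,7)]) (use 12(8) in blast)
  next
    case (13 T \<eta> f k m \<alpha>)
    show ?case by (rule char[OF 13(1,3,5,7)]) (use 13(8) in blast)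
  qed
qed

end
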